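(* Let $X$ and $Y$ be locally compact Hausdorff spaces, and let $T\colon S(C_0(X))^+\to S(C_0(Y))^+$ be a surjective phase-isometry, i.e. a surjective map satisfying $$\{\|T(f)+T(g)\|_\infty,\ \|T(f)-T(g)\|_\infty\}=\{\|f+g\|_\infty,\ \|f-g\|_\infty\}$$ (equality of sets) for all $f,g\in S(C_0(X))^+$. Then there exists a homeomorphism $\sigma\colon Y\to X$ such that $T(f)=f\circ\sigma$ for all $f\in S(C_0(X))^+$. Consequently, $T$ extends uniquely to a surjective real-linear isometry from $C_0(X)$ onto $C_0(Y)$; that is, there is exactly one surjective real-linear isometry $\tilde T\colon C_0(X)\to C_0(Y)$ with $\tilde T(f)=T(f)$ for all $f\in S(C_0(X))^+$.
   Context: For a locally compact Hausdorff space $K$, $C_0(K)$ denotes the real Banach space of all continuous real-valued functions on $K$ that vanish at infinity, equipped with the supremum norm $\|\cdot\|_\infty$. The positive unit sphere of $C_0(K)$ is $S(C_0(K))^+=\{f\in C_0(K):\|f\|_\infty=1,\ f\ge 0\}$, where $f \geq 0$ is meant pointwise. *)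

theory Defs
  imports "HOL-Analysis.Analysis"
begin

text \<open>
  Spaces are abstract topologies, so that the empty space is included. A real function on the
  space \<open>X\<close> is represented by its extension by \<open>0\<close> outside \<open>topspace X\<close>; this makes the
  representation unique and keeps it closed under the pointwise operations.
\<close>

definition C0 :: "'a topology \<Rightarrow> ('a \<Rightarrow> real) set" where
  "C0 X = {f. continuous_map X euclideanreal f
            \<and> (\<forall>\<epsilon>>0. compactin X {x \<in> topspace X. \<epsilon> \<le> \<bar>f x\<bar>})
            \<and> (\<forall>x. x \<notin> topspace X \<longrightarrow> f x = 0)}"

text \<open>
  The inserted \<open>0\<close> only matters for the empty space, where \<open>Sup {}\<close> is unspecified on the reals.
\<close>

definition sup_norm :: "'a topology \<Rightarrow> ('a \<Rightarrow> real) \<Rightarrow> real" where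
  "sup_norm X f = Sup (insert 0 ((\<lambda>x. \<bar>f x\<bar>) ` topspace X))"

definition pos_unit_sphere :: "'a topology \<Rightarrow> ('a \<Rightarrow> real) set" where
  "pos_unit_sphere X = {f \<in> C0 X. sup_norm X f = 1 \<and> (\<forall>x \<in> topspace X. 0 \<le> f x)}"

definition surj_phase_isometry ::
  "'a topology \<Rightarrow> 'b topology \<Rightarrow> (('a \<Rightarrow> real) \<Rightarrow> ('b \<Rightarrow> real)) \<Rightarrow> bool" where
  "surj_phase_isometry X Y T \<longleftrightarrow>
     T ` pos_unit_sphere X = pos_unit_sphere Y \<and>
     (\<forall>f \<in> pos_unit_sphere X. \<forall>g \<in> pos_unit_sphere X.
        {sup_norm Y (\<lambda>y. T f y + T g y), sup_norm Y (\<lambda>y. T f y - T g y)} =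
        {sup_norm X (\<lambda>x. f x + g x), sup_norm X (\<lambda>x. f x - g x)})"

text \<open>
  Maps from \<open>C0 X\<close> to \<open>C0 Y\<close> are taken in \<open>C0 X \<rightarrow>\<^sub>E C0 Y\<close>: their values off \<open>C0 X\<close> are
  irrelevant and fixed to \<open>undefined\<close>, so that unique existence is unique existence of a map on \<open>C0 X\<close>.
\<close>

definition surj_linear_isometry ::
  "'a topology \<Rightarrow> 'b topology \<Rightarrow> (('a \<Rightarrow> real) \<Rightarrow> ('b \<Rightarrow> real)) \<Rightarrow> bool" where
  "surj_linear_isometry X Y T \<longleftrightarrow>
     T \<in> C0 X \<rightarrow>\<^sub>E C0 Y \<and>
     T ` C0 X = C0 Y \<and>
     (\<forall>f \<in> C0 X. \<forall>g \<in> C0 X. T (\<lambda>x. f x + g x) = (\<lambda>y. T f y + T g y)) \<and>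
     (\<forall>c. \<forall>f \<in> C0 X. T (\<lambda>x. c * f x) = (\<lambda>y. c * T f y)) \<and>
     (\<forall>f \<in> C0 X. \<forall>g \<in> C0 X.
        sup_norm Y (\<lambda>y. T f y - T g y) = sup_norm X (\<lambda>x. f x - g x))"

end

theory Submission
  imports Defs
begin

text \<open>
  For nonnegative \<open>f\<close> and \<open>g\<close> of norm 1 one has \<open>\<parallel>f - g\<parallel> \<le> \<parallel>f + g\<parallel>\<close>, so the larger elements of the two sets
  in the definition of a phase-isometry must agree: \<open>\<parallel>T f + T g\<parallel> = \<parallel>f + g\<parallel>\<close>
  (\<open>phase_isometry_norm_add\<close>). The proof rests on this norm-additivity.
  
  Everything is read off from the functions \<open>h\<close> of the sphere with \<open>h x = 1\<close>. By Urysohn's lemma there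
  are such \<open>h\<close> that vanish outside any given neighbourhood of \<open>x\<close>, which gives
  \<open>f x = inf {\<parallel>f + h\<parallel> - 1 | h. h x = 1}\<close> (\<open>peak_function_small_norm\<close>). Two consequences follow.
  
  First, \<open>f \<le> g\<close> holds iff \<open>\<parallel>f + h\<parallel> \<le> \<parallel>g + h\<parallel>\<close> for all \<open>h\<close> in the sphere (\<open>sphere_le_iff_norm\<close>). Hence \<open>T\<close> is
  an isomorphism of ordered sets, in particular injective. The points of a space are visible in the order
  of its sphere: the set \<open>P x = {h. h x = 1}\<close> is downward directed, and by compactness the members of any
  nonempty downward directed subset of the sphere take the value 1 at a common point
  (\<open>directed_family_common_peak\<close>). So \<open>T\<close> maps \<open>P x\<close> into some \<open>P y\<close>. The same applies to the inverse of
  \<open>T\<close>, and since \<open>P x \<subseteq> P z\<close> forces \<open>x = z\<close>, one obtains \<open>\<sigma>\<close> with \<open>T h y = 1 \<longleftrightarrow> h (\<sigma> y) = 1\<close>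
  (\<open>peak_point_correspondence\<close>).
  
  Second, the formula for \<open>f x\<close> involves only \<open>P x\<close> and norms of sums, so it is transported by \<open>T\<close>, and
  \<open>T f y = f (\<sigma> y)\<close> (\<open>value_transfer\<close>). The sets \<open>{f > 0}\<close> form a base of the topology, whence \<open>\<sigma>\<close> is
  continuous; by symmetry it is a homeomorphism. Composition with \<open>\<sigma>\<close> is then a linear isometry that
  extends \<open>T\<close>, and it is the only one because the sphere spans the whole space
  (\<open>linear_map_determined_by_sphere\<close>).
\<close>

section \<open>Functions vanishing at infinity and the supremum norm\<close>

text \<open>
  Closure under the pointwise lattice and group operations follows from this: where \<open>\<bar>h\<bar> \<ge> \<epsilon>\<close>, one of \<open>\<bar>f\<bar>\<close>
  and \<open>\<bar>g\<bar>\<close> is at least \<open>\<epsilon>/2\<close>, so a closed set lies in a union of two compact ones.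
\<close>

lemma C0_dominated:
  assumes f: "f \<in> C0 X" and g: "g \<in> C0 X" and h: "continuous_map X euclideanreal h"
    and le: "\<And>x. x \<in> topspace X \<Longrightarrow> \<bar>h x\<bar> \<le> \<bar>f x\<bar> + \<bar>g x\<bar>"
    and off: "\<And>x. x \<notin> topspace X \<Longrightarrow> h x = 0"
  shows "h \<in> C0 X"
proof -
  have "compactin X {x \<in> topspace X. \<epsilon> \<le> \<bar>h x\<bar>}" if "\<epsilon> > 0" for \<epsilon> :: real
  proof (rule closed_compactin)
    show "compactin X ({x \<in> topspace X. \<epsilon>/2 \<le> \<bar>f x\<bar>} \<union> {x \<in> topspace X. \<epsilon>/2 \<le> \<bar>g x\<bar>})"
      using f g half_gt_zero[OF that] unfolding C0_def by (intro compactin_Un) blast+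
    show "{x \<in> topspace X. \<epsilon> \<le> \<bar>h x\<bar>} \<subseteq>
          {x \<in> topspace X. \<epsilon>/2 \<le> \<bar>f x\<bar>} \<union> {x \<in> topspace X. \<epsilon>/2 \<le> \<bar>g x\<bar>}"
      using le by fastforce
    show "closedin X {x \<in> topspace X. \<epsilon> \<le> \<bar>h x\<bar>}"
      using closedin_continuous_map_preimage[OF continuous_map_real_abs[OF h], of "{\<epsilon>..}"] by simp
  qed
  then show ?thesis using h off unfolding C0_def by auto
qed

lemma C0_continuous: "f \<in> C0 X \<Longrightarrow> continuous_map X euclideanreal f"
  by (simp add: C0_def)

lemma C0_outside: "f \<in> C0 X \<Longrightarrow> x \<notin> topspace X \<Longrightarrow> f x = 0"
  by (simp add: C0_def)

lemma C0_eqI: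
  assumes "f \<in> C0 X" "g \<in> C0 X" "\<And>x. x \<in> topspace X \<Longrightarrow> f x = g x"
  shows "f = g"
  using assms C0_outside by (metis ext)

lemma C0_add: "f \<in> C0 X \<Longrightarrow> g \<in> C0 X \<Longrightarrow> (\<lambda>x. f x + g x) \<in> C0 X"
  by (rule C0_dominated[of f X g]) (auto simp: C0_continuous C0_outside intro!: continuous_intros)

lemma C0_diff: "f \<in> C0 X \<Longrightarrow> g \<in> C0 X \<Longrightarrow> (\<lambda>x. f x - g x) \<in> C0 X"
  by (rule C0_dominated[of f X g]) (auto simp: C0_continuous C0_outside intro!: continuous_intros)

lemma C0_min: "f \<in> C0 X \<Longrightarrow> g \<in> C0 X \<Longrightarrow> (\<lambda>x. min (f x) (g x)) \<in> C0 X"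
  by (rule C0_dominated[of f X g]) (auto simp: C0_continuous C0_outside intro!: continuous_intros)

lemma C0_pos_part: "f \<in> C0 X \<Longrightarrow> (\<lambda>x. max (f x) 0) \<in> C0 X"
  by (rule C0_dominated[of f X f]) (auto simp: C0_continuous C0_outside intro!: continuous_intros)

lemma C0_cmult:
  assumes f: "f \<in> C0 X"
  shows "(\<lambda>x. c * f x) \<in> C0 X"
proof (cases "c = 0")
  case True
  then show ?thesis
    by (intro C0_dominated[OF f f]) auto
next
  case False
  have "compactin X {x \<in> topspace X. \<epsilon> \<le> \<bar>c * f x\<bar>}" if "\<epsilon> > 0" for \<epsilon>
  proof -
    have "{x \<in> topspace X. \<epsilon> \<le> \<bar>c * f x\<bar>} = {x \<in> topspace X. \<epsilon> / \<bar>c\<bar> \<le> \<bar>f x\<bar>}"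
      using False by (auto simp: abs_mult field_simps)
    moreover have "\<epsilon> / \<bar>c\<bar> > 0" using False that by simp
    ultimately show ?thesis using f unfolding C0_def by simp
  qed
  then show ?thesis
    using f unfolding C0_def by (auto intro: continuous_map_real_mult_left)
qed

text \<open>
  Attainment holds because \<open>{x. \<bar>f p\<bar> \<le> \<bar>f x\<bar>}\<close> is compact as soon as \<open>f p \<noteq> 0\<close>.
\<close>

lemma C0_attains_max:
  assumes f: "f \<in> C0 X" and p: "p \<in> topspace X"
  obtains x where "x \<in> topspace X" "\<And>z. z \<in> topspace X \<Longrightarrow> \<bar>f z\<bar> \<le> \<bar>f x\<bar>"
proof (cases "\<forall>z\<in>topspace X. f z = 0")
  case True
  then show ?thesis using p that by auto
next
  case False
  then obtain q where q: "q \<in> topspace X" "f q \<noteq> 0" by blast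
  define K where "K = {x \<in> topspace X. \<bar>f q\<bar> \<le> \<bar>f x\<bar>}"
  have K: "compactin X K"
    using f q unfolding K_def C0_def by simp
  have "compact ((\<lambda>x. \<bar>f x\<bar>) ` K)"
    using image_compactin[OF K continuous_map_real_abs[OF C0_continuous[OF f]]] by simp
  moreover have "q \<in> K" using q unfolding K_def by simp
  ultimately obtain x where x: "x \<in> K" "\<forall>z\<in>K. \<bar>f z\<bar> \<le> \<bar>f x\<bar>"
    using compact_attains_sup[of "(\<lambda>x. \<bar>f x\<bar>) ` K"] by blast
  have "\<bar>f z\<bar> \<le> \<bar>f x\<bar>" if "z \<in> topspace X" for z
    using x that unfolding K_def by fastforce
  then show ?thesis using that x unfolding K_def by blast
qed

lemma sup_norm_le_iff:
  assumes f: "f \<in> C0 X"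
  shows "sup_norm X f \<le> c \<longleftrightarrow> 0 \<le> c \<and> (\<forall>x\<in>topspace X. \<bar>f x\<bar> \<le> c)"
proof -
  have "bdd_above (insert 0 ((\<lambda>x. \<bar>f x\<bar>) ` topspace X))"
  proof (cases "topspace X = {}")
    case False
    then obtain x where "\<And>z. z \<in> topspace X \<Longrightarrow> \<bar>f z\<bar> \<le> \<bar>f x\<bar>"
      using C0_attains_max[OF f] by (metis ex_in_conv)
    then show ?thesis by (intro bdd_aboveI[of _ "\<bar>f x\<bar>"]) auto
  qed simp
  then show ?thesis
    unfolding sup_norm_def by (subst cSup_le_iff) auto
qed

lemma sup_norm_nonneg: "f \<in> C0 X \<Longrightarrow> 0 \<le> sup_norm X f"
  using sup_norm_le_iff[of f X "sup_norm X f"] by simp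

lemma abs_le_sup_norm: "f \<in> C0 X \<Longrightarrow> x \<in> topspace X \<Longrightarrow> \<bar>f x\<bar> \<le> sup_norm X f"
  using sup_norm_le_iff[of f X "sup_norm X f"] by simp

lemma sup_norm_attained:
  assumes f: "f \<in> C0 X" and pos: "sup_norm X f > 0"
  obtains x where "x \<in> topspace X" "\<bar>f x\<bar> = sup_norm X f"
proof -
  have "topspace X \<noteq> {}"
    using sup_norm_le_iff[OF f, of 0] pos by auto
  then obtain x where x: "x \<in> topspace X" "\<And>z. z \<in> topspace X \<Longrightarrow> \<bar>f z\<bar> \<le> \<bar>f x\<bar>"
    using C0_attains_max[OF f] by (metis ex_in_conv)
  then have "sup_norm X f \<le> \<bar>f x\<bar>"
    by (simp add: sup_norm_le_iff[OF f])
  then show ?thesis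
    using that x(1) abs_le_sup_norm[OF f x(1)] by (metis order_antisym)
qed

section \<open>The positive unit sphere\<close>

text \<open>
  The norm of a function vanishing at infinity is attained, so norm 1 means that the value 1 is taken.
  This replaces the supremum by pointwise conditions.
\<close>

lemma pos_unit_sphere_iff:
  "f \<in> pos_unit_sphere X \<longleftrightarrow>
     f \<in> C0 X \<and> (\<forall>x\<in>topspace X. 0 \<le> f x \<and> f x \<le> 1) \<and> (\<exists>x\<in>topspace X. f x = 1)"
  (is "?L \<longleftrightarrow> ?R")
proof
  assume L: ?L
  then have f: "f \<in> C0 X" "sup_norm X f = 1" "\<forall>x\<in>topspace X. 0 \<le> f x"
    by (auto simp: pos_unit_sphere_def)
  obtain x where "x \<in> topspace X" "\<bar>f x\<bar> = 1"
    using sup_norm_attained[OF f(1)] f(2) by auto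
  then show ?R
    using f abs_le_sup_norm[OF f(1)] by (metis abs_of_nonneg)
next
  assume R: ?R
  then obtain x where x: "f \<in> C0 X" "x \<in> topspace X" "f x = 1" by blast
  have "sup_norm X f \<le> 1"
    using R by (auto simp: sup_norm_le_iff)
  moreover have "1 \<le> sup_norm X f"
    using abs_le_sup_norm[OF x(1,2)] x(3) by simp
  ultimately show ?L using R by (simp add: pos_unit_sphere_def)
qed

lemma pos_unit_sphere_C0: "f \<in> pos_unit_sphere X \<Longrightarrow> f \<in> C0 X"
  by (simp add: pos_unit_sphere_def)

lemma sup_norm_sphere_add_le_iff:
  assumes "f \<in> pos_unit_sphere X" "g \<in> pos_unit_sphere X"
  shows "sup_norm X (\<lambda>x. f x + g x) \<le> c \<longleftrightarrow> (\<forall>x\<in>topspace X. f x + g x \<le> c)"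
proof -
  have "0 \<le> c" if "\<forall>x\<in>topspace X. f x + g x \<le> c"
    using that assms unfolding pos_unit_sphere_iff by force
  moreover have "\<bar>f x + g x\<bar> = f x + g x" if "x \<in> topspace X" for x
    using that assms unfolding pos_unit_sphere_iff by simp
  ultimately show ?thesis
    using assms by (auto simp: sup_norm_le_iff C0_add pos_unit_sphere_C0)
qed

lemma sphere_add_le_sup_norm:
  assumes "f \<in> pos_unit_sphere X" "g \<in> pos_unit_sphere X" "x \<in> topspace X"
  shows "f x + g x \<le> sup_norm X (\<lambda>x. f x + g x)"
  using sup_norm_sphere_add_le_iff[OF assms(1,2), THEN iffD1, OF order_refl] assms(3) by (rule bspec)

text \<open>
  The common peak \<open>x\<close> keeps the norm of the minimum at 1. This is what makes the set of functions with
  value 1 at \<open>x\<close> downward directed.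
\<close>

lemma min_in_sphere:
  assumes "f \<in> pos_unit_sphere X" "g \<in> pos_unit_sphere X" "x \<in> topspace X" "f x = 1" "g x = 1"
  shows "(\<lambda>x. min (f x) (g x)) \<in> pos_unit_sphere X"
  using assms unfolding pos_unit_sphere_iff by (auto simp: C0_min intro!: bexI[of _ x])

text \<open>
  Complete regularity gives a function that is 1 at \<open>x\<close> and vanishes off \<open>U\<close>. Shrinking \<open>U\<close> into a
  compact neighbourhood of \<open>x\<close> makes this function vanish at infinity.
\<close>

lemma bump_function:
  assumes X: "locally_compact_space X" "Hausdorff_space X" and U: "openin X U" and x: "x \<in> U"
  obtains h where "h \<in> pos_unit_sphere X" "h x = 1" "\<And>z. z \<in> topspace X \<Longrightarrow> z \<notin> U \<Longrightarrow> h z = 0"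
proof -
  have xX: "x \<in> topspace X" using U x openin_subset by blast
  then obtain V K where V: "openin X V" "compactin X K" "x \<in> V" "V \<subseteq> K"
    using X(1) unfolding locally_compact_space_def by meson
  define C where "C = topspace X - U \<inter> V"
  have "closedin X C" unfolding C_def using U V by blast
  moreover have "x \<in> topspace X - C" unfolding C_def using xX x V by blast
  ultimately obtain u :: "'a \<Rightarrow> real" where u: "continuous_map X (top_of_set {0..1}) u" "u x = 0" "u ` C \<subseteq> {1}"
    using locally_compact_regular_imp_completely_regular_space[of X] X
    unfolding completely_regular_space_def by blast
  have uc: "continuous_map X euclideanreal u" and u01: "\<And>z. z \<in> topspace X \<Longrightarrow> 0 \<le> u z \<and> u z \<le> 1"
    using u(1) unfolding continuous_map_in_subtopology by auto
  define h where "h = (\<lambda>z. if z \<in> topspace X then 1 - u z else 0)"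
  have "continuous_map X euclideanreal (\<lambda>z. 1 - u z)"
    using uc by (intro continuous_intros)
  then have hc: "continuous_map X euclideanreal h"
    by (rule continuous_map_eq) (simp add: h_def)
  have hC: "h z = 0" if "z \<in> topspace X" "z \<notin> U \<inter> V" for z
    using u(3) that unfolding h_def C_def by auto
  have "compactin X {z \<in> topspace X. \<epsilon> \<le> \<bar>h z\<bar>}" if "\<epsilon> > 0" for \<epsilon>
  proof (rule closed_compactin[OF V(2)])
    show "{z \<in> topspace X. \<epsilon> \<le> \<bar>h z\<bar>} \<subseteq> K"
      using hC V(4) that by force
    show "closedin X {z \<in> topspace X. \<epsilon> \<le> \<bar>h z\<bar>}"
      using closedin_continuous_map_preimage[OF continuous_map_real_abs[OF hc], of "{\<epsilon>..}"] by simp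
  qed
  then have "h \<in> C0 X"
    using hc unfolding C0_def by (auto simp: h_def)
  moreover have "h x = 1" using xX u(2) by (simp add: h_def)
  moreover have "0 \<le> h z \<and> h z \<le> 1" if "z \<in> topspace X" for z
    using u01[OF that] that by (simp add: h_def)
  ultimately have "h \<in> pos_unit_sphere X"
    using xX unfolding pos_unit_sphere_iff by blast
  with \<open>h x = 1\<close> hC that show ?thesis by blast
qed

lemma sphere_separates_points:
  assumes X: "locally_compact_space X" "Hausdorff_space X"
    and x: "x \<in> topspace X" and z: "z \<in> topspace X"
    and peak: "\<And>h. h \<in> pos_unit_sphere X \<Longrightarrow> h x = 1 \<Longrightarrow> h z = 1"
  shows "x = z"
proof (rule ccontr)
  assume "x \<noteq> z"
  moreover have "openin X (topspace X - {z})"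
    using X(2) z by (simp add: openin_diff closedin_Hausdorff_singleton)
  ultimately obtain h where "h \<in> pos_unit_sphere X" "h x = 1" "h z = 0"
    using bump_function[OF X, of "topspace X - {z}" x] x z by auto
  with peak show False by force
qed

text \<open>
  Take \<open>h\<close> supported in \<open>{z. f z < f x + e}\<close>: on that set the sum is below \<open>f x + e + 1\<close>, and elsewhere it
  equals \<open>f \<le> 1\<close>. As \<open>f x + 1 \<le> \<parallel>f + h\<parallel>\<close> is clear for all \<open>h\<close> with \<open>h x = 1\<close>, the value \<open>f x\<close> is determined by the
  norms of such sums.
\<close>

lemma peak_function_small_norm:
  assumes X: "locally_compact_space X" "Hausdorff_space X"
    and f: "f \<in> pos_unit_sphere X" and x: "x \<in> topspace X" and e: "e > 0"
  obtains h where "h \<in> pos_unit_sphere X" "h x = 1" "sup_norm X (\<lambda>z. f z + h z) \<le> 1 + f x + e"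
proof -
  define U where "U = {z \<in> topspace X. f z \<in> {..<f x + e}}"
  have "openin X U"
    unfolding U_def
    by (rule openin_continuous_map_preimage[OF C0_continuous[OF pos_unit_sphere_C0[OF f]]]) simp
  moreover have "x \<in> U" using x e by (simp add: U_def)
  ultimately obtain h where h: "h \<in> pos_unit_sphere X" "h x = 1"
      "\<And>z. z \<in> topspace X \<Longrightarrow> z \<notin> U \<Longrightarrow> h z = 0"
    using bump_function[OF X] by blast
  have "f z + h z \<le> 1 + f x + e" if z: "z \<in> topspace X" for z
  proof (cases "z \<in> U")
    case True
    then show ?thesis using h(1) z by (force simp: U_def pos_unit_sphere_iff)
  next
    case False
    then have "f z + h z \<le> 1" using h(3)[OF z] f z by (simp add: pos_unit_sphere_iff)
    moreover have "0 \<le> f x" using f x by (simp add: pos_unit_sphere_iff)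
    ultimately show ?thesis using e by linarith
  qed
  then show ?thesis
    using that h(1,2) sup_norm_sphere_add_le_iff[OF f h(1)] by blast
qed

text \<open>
  The order of the sphere is expressed by norms of sums. For the converse direction, test with functions \<open>h\<close> that peak
  at \<open>x\<close> and for which \<open>\<parallel>g + h\<parallel>\<close> is nearly \<open>1 + g x\<close>.
\<close>

lemma sphere_le_iff_norm:
  assumes X: "locally_compact_space X" "Hausdorff_space X"
    and f: "f \<in> pos_unit_sphere X" and g: "g \<in> pos_unit_sphere X"
  shows "(\<forall>x\<in>topspace X. f x \<le> g x) \<longleftrightarrow>
    (\<forall>h\<in>pos_unit_sphere X. sup_norm X (\<lambda>x. f x + h x) \<le> sup_norm X (\<lambda>x. g x + h x))"
  (is "?L \<longleftrightarrow> ?R")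
proof
  assume L: ?L
  show ?R
  proof
    fix h assume h: "h \<in> pos_unit_sphere X"
    show "sup_norm X (\<lambda>x. f x + h x) \<le> sup_norm X (\<lambda>x. g x + h x)"
      unfolding sup_norm_sphere_add_le_iff[OF f h]
      using L sphere_add_le_sup_norm[OF g h] by (meson add_right_mono order_trans)
  qed
next
  assume R: ?R
  show ?L
  proof (rule ballI, rule field_le_epsilon)
    fix x and e :: real assume x: "x \<in> topspace X" and e: "0 < e"
    obtain h where h: "h \<in> pos_unit_sphere X" "h x = 1" "sup_norm X (\<lambda>z. g z + h z) \<le> 1 + g x + e"
      by (rule peak_function_small_norm[OF X g x e])
    have "f x + h x \<le> sup_norm X (\<lambda>z. f z + h z)"
      by (rule sphere_add_le_sup_norm[OF f h(1) x])
    moreover have "sup_norm X (\<lambda>z. f z + h z) \<le> sup_norm X (\<lambda>z. g z + h z)"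
      using R h(1) by (rule bspec)
    ultimately show "f x \<le> g x + e" using h(2,3) by linarith
  qed
qed

text \<open>
  The peak sets \<open>{x. f x = 1}\<close> are compact. A lower bound in the sphere of finitely many members peaks
  somewhere, and all those members peak there too; so the peak sets have the finite intersection property.
  Pairwise intersecting peak sets would not suffice, which is why the order is needed.
\<close>

lemma directed_family_common_peak:
  assumes F: "F \<subseteq> pos_unit_sphere X" "F \<noteq> {}"
    and dir: "\<And>f g. f \<in> F \<Longrightarrow> g \<in> F \<Longrightarrow> \<exists>h\<in>F. \<forall>x\<in>topspace X. h x \<le> f x \<and> h x \<le> g x"
  obtains x where "x \<in> topspace X" "\<And>f. f \<in> F \<Longrightarrow> f x = 1"
proof -
  define P where "P f = {x \<in> topspace X. f x = 1}" for f :: "'a \<Rightarrow> real"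
  have P: "P f = {x \<in> topspace X. f x \<in> {1}}" for f by (simp add: P_def)
  have closed: "closedin X (P f)" if "f \<in> F" for f
  proof -
    have "f \<in> C0 X" using that F pos_unit_sphere_C0 by blast
    then show ?thesis
      unfolding P by (rule closedin_continuous_map_preimage[OF C0_continuous]) simp
  qed
  obtain f0 where f0: "f0 \<in> F" using F(2) by blast
  have compact: "compactin X (P f0)"
  proof (rule closed_compactin)
    show "compactin X {x \<in> topspace X. 1 \<le> \<bar>f0 x\<bar>}"
      using f0 F pos_unit_sphere_C0[of f0 X] by (auto simp: C0_def)
  qed (use closed f0 in \<open>auto simp: P_def\<close>)
  have below: "\<exists>h\<in>F. \<forall>f\<in>G. \<forall>x\<in>topspace X. h x \<le> f x" if "finite G" "G \<subseteq> F" for G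
    using that
  proof (induction G rule: finite_induct)
    case empty
    then show ?case using f0 by auto
  next
    case (insert g G)
    then obtain h where h: "h \<in> F" "\<forall>f\<in>G. \<forall>x\<in>topspace X. h x \<le> f x" by auto
    then obtain k where k: "k \<in> F" "\<forall>x\<in>topspace X. k x \<le> g x \<and> k x \<le> h x"
      using dir[of g h] insert.prems by auto
    have "\<forall>f\<in>insert g G. \<forall>x\<in>topspace X. k x \<le> f x"
      using h(2) k(2) by (metis insert_iff order_trans)
    with k(1) show ?case by blast
  qed
  have "P f0 \<inter> \<Inter>(P ` F) \<noteq> {}"
  proof (rule compactin_fip[THEN iffD1, OF compact, THEN conjunct2, rule_format])
    show "(\<forall>C\<in>P ` F. closedin X C) \<and> (\<forall>\<F>. finite \<F> \<and> \<F> \<subseteq> P ` F \<longrightarrow> P f0 \<inter> \<Inter> \<F> \<noteq> {})"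
    proof (intro conjI allI impI)
      fix \<F> assume "finite \<F> \<and> \<F> \<subseteq> P ` F"
      then obtain G where G: "finite G" "G \<subseteq> F" "\<F> = P ` G"
        by (meson finite_subset_image)
      then obtain h where h: "h \<in> F" "\<forall>f\<in>insert f0 G. \<forall>x\<in>topspace X. h x \<le> f x"
        using below[of "insert f0 G"] f0 by auto
      then obtain x where x: "x \<in> topspace X" "h x = 1"
        using subsetD[OF F(1) h(1)] unfolding pos_unit_sphere_iff by blast
      have "x \<in> P f" if f: "f \<in> insert f0 G" for f
      proof -
        have "f \<in> pos_unit_sphere X" using f f0 G F by auto
        then have "f x \<le> 1" using x by (simp add: pos_unit_sphere_iff)
        moreover have "1 \<le> f x" using h f x by force
        ultimately show ?thesis using x by (simp add: P_def)
      qed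
      then show "P f0 \<inter> \<Inter> \<F> \<noteq> {}" using G by blast
    qed (use closed in auto)
  qed
  then obtain x where "x \<in> topspace X" "\<And>f. f \<in> F \<Longrightarrow> f x = 1"
    unfolding P_def using f0 by auto
  then show ?thesis using that by blast
qed

section \<open>Norm-additive surjections between positive unit spheres\<close>

text \<open>
  A phase-isometry enters the argument only through these properties, which pass to the inverse map.
  Every fact about \<open>T\<close> is therefore available in both directions.
\<close>

locale norm_additive_surjection =
  fixes X :: "'a topology" and Y :: "'b topology"
    and T :: "('a \<Rightarrow> real) \<Rightarrow> ('b \<Rightarrow> real)"
  assumes X: "locally_compact_space X" "Hausdorff_space X"
    and Y: "locally_compact_space Y" "Hausdorff_space Y"
    and surj: "T ` pos_unit_sphere X = pos_unit_sphere Y"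
    and norm_add: "\<And>f g. f \<in> pos_unit_sphere X \<Longrightarrow> g \<in> pos_unit_sphere X \<Longrightarrow>
      sup_norm Y (\<lambda>y. T f y + T g y) = sup_norm X (\<lambda>x. f x + g x)"
begin

lemma T_in: "f \<in> pos_unit_sphere X \<Longrightarrow> T f \<in> pos_unit_sphere Y"
  using surj by blast

lemma le_iff:
  assumes "f \<in> pos_unit_sphere X" "g \<in> pos_unit_sphere X"
  shows "(\<forall>y\<in>topspace Y. T f y \<le> T g y) \<longleftrightarrow> (\<forall>x\<in>topspace X. f x \<le> g x)"
  using assms
  by (simp add: sphere_le_iff_norm X Y T_in norm_add flip: surj)

lemma inj: "inj_on T (pos_unit_sphere X)"
proof (rule inj_onI)
  fix f g assume fg: "f \<in> pos_unit_sphere X" "g \<in> pos_unit_sphere X" "T f = T g"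
  have "f x = g x" if "x \<in> topspace X" for x
    using le_iff[OF fg(1,2)] le_iff[OF fg(2,1)] fg(3) that by (simp add: order_antisym)
  then show "f = g"
    using fg by (intro C0_eqI[of f X g]) (auto simp: pos_unit_sphere_C0)
qed

lemma inverse: "norm_additive_surjection Y X (inv_into (pos_unit_sphere X) T)"
proof
  let ?R = "inv_into (pos_unit_sphere X) T"
  show "?R ` pos_unit_sphere Y = pos_unit_sphere X"
    using inv_into_image_cancel[OF inj order_refl] surj by simp
  fix k l assume "k \<in> pos_unit_sphere Y" "l \<in> pos_unit_sphere Y"
  then show "sup_norm X (\<lambda>x. ?R k x + ?R l x) = sup_norm Y (\<lambda>y. k y + l y)"
    using norm_add[of "?R k" "?R l"] surj by (simp add: inv_into_into f_inv_into_f)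
qed (use X Y in auto)

text \<open>
  The set \<open>P\<close> of functions peaking at \<open>x\<close> is downward directed, and \<open>T\<close> preserves the order; hence the
  members of \<open>T ` P\<close> have a common peak.
\<close>

lemma peak_point_image:
  assumes x: "x \<in> topspace X"
  shows "\<exists>y\<in>topspace Y. \<forall>h\<in>pos_unit_sphere X. h x = 1 \<longrightarrow> T h y = 1"
proof -
  define P where "P = {h \<in> pos_unit_sphere X. h x = 1}"
  have "\<exists>h\<in>T ` P. \<forall>y\<in>topspace Y. h y \<le> k y \<and> h y \<le> l y"
    if kl: "k \<in> T ` P" "l \<in> T ` P" for k l
  proof -
    obtain f g where fg: "f \<in> P" "g \<in> P" "k = T f" "l = T g" using kl by blast
    define m where "m = (\<lambda>x. min (f x) (g x))"
    have m: "m \<in> P"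
      using fg min_in_sphere[of f X g x] x unfolding P_def m_def by simp
    have "\<forall>y\<in>topspace Y. T m y \<le> T f y" "\<forall>y\<in>topspace Y. T m y \<le> T g y"
      using m fg le_iff[of m] unfolding P_def by (auto simp: m_def)
    with m fg show ?thesis by blast
  qed
  moreover have "T ` P \<subseteq> pos_unit_sphere Y" unfolding P_def using T_in by blast
  moreover have "T ` P \<noteq> {}"
    using bump_function[OF X openin_topspace x] unfolding P_def by blast
  ultimately obtain y where "y \<in> topspace Y" "\<And>k. k \<in> T ` P \<Longrightarrow> k y = 1"
    using directed_family_common_peak[of "T ` P" Y] by blast
  then show ?thesis unfolding P_def by blast
qed

text \<open>
  Going from \<open>y\<close> to a point \<open>x\<close> by the inverse of \<open>T\<close> and back to a point \<open>z\<close> by \<open>T\<close>, every function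
  peaking at \<open>y\<close> also peaks at \<open>z\<close>. So \<open>z = y\<close>, and the two one-sided implications combine to an
  equivalence.
\<close>

lemma peak_point_correspondence:
  obtains \<sigma> where "\<And>y. y \<in> topspace Y \<Longrightarrow> \<sigma> y \<in> topspace X"
    "\<And>y h. y \<in> topspace Y \<Longrightarrow> h \<in> pos_unit_sphere X \<Longrightarrow> T h y = 1 \<longleftrightarrow> h (\<sigma> y) = 1"
proof -
  interpret inv: norm_additive_surjection Y X "inv_into (pos_unit_sphere X) T"
    by (rule inverse)
  have "\<exists>x\<in>topspace X. \<forall>h\<in>pos_unit_sphere X. T h y = 1 \<longleftrightarrow> h x = 1" if y: "y \<in> topspace Y" for y
  proof -
    obtain x where x: "x \<in> topspace X"
      and yx: "\<And>k. k \<in> pos_unit_sphere Y \<Longrightarrow> k y = 1 \<Longrightarrow> inv_into (pos_unit_sphere X) T k x = 1"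
      using inv.peak_point_image[OF y] by blast
    have fwd: "h x = 1" if "h \<in> pos_unit_sphere X" "T h y = 1" for h
      using yx[OF T_in] that by (simp add: inv_into_f_f[OF inj])
    obtain z where z: "z \<in> topspace Y" "\<And>h. h \<in> pos_unit_sphere X \<Longrightarrow> h x = 1 \<Longrightarrow> T h z = 1"
      using peak_point_image[OF x] by blast
    have "y = z"
    proof (rule sphere_separates_points[OF Y y z(1)])
      fix k assume k: "k \<in> pos_unit_sphere Y" "k y = 1"
      then obtain h where "h \<in> pos_unit_sphere X" "k = T h" using surj by blast
      then show "k z = 1" using fwd[of h] z(2)[of h] k(2) by simp
    qed
    then have "\<forall>h\<in>pos_unit_sphere X. T h y = 1 \<longleftrightarrow> h x = 1" using fwd z(2) by auto
    with x show ?thesis by (rule bexI[rotated])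
  qed
  then show ?thesis using that by metis
qed

text \<open>
  Both values are the infimum of the same norms of sums, by \<open>peak_function_small_norm\<close> in \<open>X\<close> and in \<open>Y\<close>:
  the functions peaking at \<open>x\<close> and those peaking at \<open>y\<close> correspond under \<open>T\<close>.
\<close>

lemma value_transfer:
  assumes f: "f \<in> pos_unit_sphere X" and x: "x \<in> topspace X" and y: "y \<in> topspace Y"
    and peak: "\<And>h. h \<in> pos_unit_sphere X \<Longrightarrow> T h y = 1 \<longleftrightarrow> h x = 1"
  shows "T f y = f x"
proof (rule order_antisym; rule field_le_epsilon)
  fix e :: real assume e: "0 < e"
  obtain h where h: "h \<in> pos_unit_sphere X" "h x = 1" "sup_norm X (\<lambda>z. f z + h z) \<le> 1 + f x + e"
    by (rule peak_function_small_norm[OF X f x e])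
  have "T f y + T h y \<le> sup_norm Y (\<lambda>y. T f y + T h y)"
    by (rule sphere_add_le_sup_norm[OF T_in[OF f] T_in[OF h(1)] y])
  then show "T f y \<le> f x + e"
    using h peak[OF h(1)] norm_add[OF f h(1)] by simp
  obtain k where k: "k \<in> pos_unit_sphere Y" "k y = 1" "sup_norm Y (\<lambda>z. T f z + k z) \<le> 1 + T f y + e"
    by (rule peak_function_small_norm[OF Y T_in[OF f] y e])
  then obtain g where g: "g \<in> pos_unit_sphere X" "k = T g" using surj by blast
  have "f x + g x \<le> sup_norm X (\<lambda>x. f x + g x)"
    by (rule sphere_add_le_sup_norm[OF f g(1) x])
  then show "f x \<le> T f y + e"
    using k g peak[OF g(1)] norm_add[OF f g(1)] by simp
qed

lemma composition_operator:
  obtains \<sigma> where "\<And>y. y \<in> topspace Y \<Longrightarrow> \<sigma> y \<in> topspace X"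
    "\<And>f y. f \<in> pos_unit_sphere X \<Longrightarrow> y \<in> topspace Y \<Longrightarrow> T f y = f (\<sigma> y)"
proof -
  obtain \<sigma> where \<sigma>: "\<And>y. y \<in> topspace Y \<Longrightarrow> \<sigma> y \<in> topspace X"
    "\<And>y h. y \<in> topspace Y \<Longrightarrow> h \<in> pos_unit_sphere X \<Longrightarrow> T h y = 1 \<longleftrightarrow> h (\<sigma> y) = 1"
    using peak_point_correspondence by blast
  show ?thesis
  proof (rule that[of \<sigma>])
    fix f y assume f: "f \<in> pos_unit_sphere X" and y: "y \<in> topspace Y"
    show "T f y = f (\<sigma> y)"
      by (rule value_transfer[OF f \<sigma>(1)[OF y] y \<sigma>(2)[OF y]])
  qed (rule \<sigma>(1))
qed

end

text \<open>
  Bump functions show that the sets \<open>{x. 0 < f x}\<close> with \<open>f\<close> in the sphere are a base of the topology,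
  so \<open>X\<close> carries the initial topology of the sphere.
\<close>

lemma continuous_map_if_sphere_continuous:
  assumes X: "locally_compact_space X" "Hausdorff_space X"
    and \<sigma>: "\<And>y. y \<in> topspace Y \<Longrightarrow> \<sigma> y \<in> topspace X"
    and cont: "\<And>f. f \<in> pos_unit_sphere X \<Longrightarrow> continuous_map Y euclideanreal (\<lambda>y. f (\<sigma> y))"
  shows "continuous_map Y X \<sigma>"
  unfolding continuous_map_def
proof (intro conjI allI impI)
  show "\<sigma> \<in> topspace Y \<rightarrow> topspace X" using \<sigma> by blast
  fix U assume U: "openin X U"
  show "openin Y {y \<in> topspace Y. \<sigma> y \<in> U}"
  proof (subst openin_subopen, intro ballI)
    fix y assume "y \<in> {y \<in> topspace Y. \<sigma> y \<in> U}"
    then have y: "y \<in> topspace Y" "\<sigma> y \<in> U" by auto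
    obtain h where h: "h \<in> pos_unit_sphere X" "h (\<sigma> y) = 1"
        "\<And>z. z \<in> topspace X \<Longrightarrow> z \<notin> U \<Longrightarrow> h z = 0"
      using bump_function[OF X U y(2)] by blast
    define V where "V = {y \<in> topspace Y. h (\<sigma> y) \<in> {0<..}}"
    have "openin Y V"
      unfolding V_def by (rule openin_continuous_map_preimage[OF cont[OF h(1)]]) simp
    moreover have "y \<in> V" using y h by (simp add: V_def)
    moreover have "V \<subseteq> {y \<in> topspace Y. \<sigma> y \<in> U}"
      using h(3) \<sigma> unfolding V_def by force
    ultimately show "\<exists>V. openin Y V \<and> y \<in> V \<and> V \<subseteq> {y \<in> topspace Y. \<sigma> y \<in> U}" by blast
  qed
qed

context norm_additive_surjection
begin

text \<open>
  Both \<open>T\<close> and its inverse are composition operators, with \<open>\<sigma>\<close> and \<open>\<tau>\<close>. The composite \<open>\<tau> \<circ> \<sigma>\<close> leaves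
  the value of every function of the sphere at \<open>y\<close> unchanged, and these functions separate points; likewise for \<open>\<sigma> \<circ> \<tau>\<close>.
\<close>

lemma homeomorphism:
  obtains \<sigma> where "homeomorphic_map Y X \<sigma>"
    "\<And>f y. f \<in> pos_unit_sphere X \<Longrightarrow> y \<in> topspace Y \<Longrightarrow> T f y = f (\<sigma> y)"
proof -
  let ?R = "inv_into (pos_unit_sphere X) T"
  interpret inv: norm_additive_surjection Y X ?R
    by (rule inverse)
  obtain \<sigma> where \<sigma>: "\<And>y. y \<in> topspace Y \<Longrightarrow> \<sigma> y \<in> topspace X"
    "\<And>f y. f \<in> pos_unit_sphere X \<Longrightarrow> y \<in> topspace Y \<Longrightarrow> T f y = f (\<sigma> y)"
    using composition_operator by blast
  obtain \<tau> where \<tau>: "\<And>x. x \<in> topspace X \<Longrightarrow> \<tau> x \<in> topspace Y"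
    "\<And>k x. k \<in> pos_unit_sphere Y \<Longrightarrow> x \<in> topspace X \<Longrightarrow> ?R k x = k (\<tau> x)"
    using inv.composition_operator by blast
  have RT: "?R (T f) = f" if "f \<in> pos_unit_sphere X" for f
    using inv_into_f_f[OF inj that] .
  have TR: "T (?R k) = k" if "k \<in> pos_unit_sphere Y" for k
    using f_inv_into_f that surj by metis
  have "continuous_map Y X \<sigma>"
  proof (rule continuous_map_if_sphere_continuous[OF X \<sigma>(1)])
    fix f assume f: "f \<in> pos_unit_sphere X"
    show "continuous_map Y euclideanreal (\<lambda>y. f (\<sigma> y))"
      by (rule continuous_map_eq[OF C0_continuous[OF pos_unit_sphere_C0[OF T_in[OF f]]] \<sigma>(2)[OF f]])
  qed
  moreover have "continuous_map X Y \<tau>"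
  proof (rule continuous_map_if_sphere_continuous[OF Y \<tau>(1)])
    fix k assume k: "k \<in> pos_unit_sphere Y"
    show "continuous_map X euclideanreal (\<lambda>x. k (\<tau> x))"
      by (rule continuous_map_eq[OF C0_continuous[OF pos_unit_sphere_C0[OF inv.T_in[OF k]]] \<tau>(2)[OF k]])
  qed
  moreover have "\<tau> (\<sigma> y) = y" if y: "y \<in> topspace Y" for y
  proof (rule sphere_separates_points[OF Y y \<tau>(1)[OF \<sigma>(1)[OF y]], symmetric])
    fix k assume "k \<in> pos_unit_sphere Y" "k y = 1"
    then show "k (\<tau> (\<sigma> y)) = 1"
      using \<tau>(2)[of k "\<sigma> y"] \<sigma>(2)[of "?R k" y] \<sigma>(1) y TR inv.T_in by metis
  qed
  moreover have "\<sigma> (\<tau> x) = x" if x: "x \<in> topspace X" for x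
  proof (rule sphere_separates_points[OF X x \<sigma>(1)[OF \<tau>(1)[OF x]], symmetric])
    fix f assume "f \<in> pos_unit_sphere X" "f x = 1"
    then show "f (\<sigma> (\<tau> x)) = 1"
      using \<sigma>(2)[of f "\<tau> x"] \<tau>(2)[of "T f" x] \<tau>(1) x RT T_in by metis
  qed
  ultimately have "homeomorphic_maps Y X \<sigma> \<tau>"
    unfolding homeomorphic_maps_def by blast
  then show ?thesis using that \<sigma>(2) homeomorphic_map_maps by blast
qed

end

lemma sphere_norm_diff_le_norm_add:
  assumes f: "f \<in> pos_unit_sphere X" and g: "g \<in> pos_unit_sphere X"
  shows "sup_norm X (\<lambda>x. f x - g x) \<le> sup_norm X (\<lambda>x. f x + g x)"
proof -
  have C0: "f \<in> C0 X" "g \<in> C0 X" using f g by (auto simp: pos_unit_sphere_C0)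
  have "\<bar>f x - g x\<bar> \<le> sup_norm X (\<lambda>x. f x + g x)" if x: "x \<in> topspace X" for x
  proof -
    have "0 \<le> f x" "0 \<le> g x" using f g x by (auto simp: pos_unit_sphere_iff)
    then show ?thesis using sphere_add_le_sup_norm[OF f g x] by linarith
  qed
  then show ?thesis
    using sup_norm_nonneg[OF C0_add[OF C0]] by (simp add: sup_norm_le_iff[OF C0_diff[OF C0]])
qed

text \<open>
  In each of the two sets of norms, the norm of the sum is the maximum.
\<close>

lemma phase_isometry_norm_add:
  assumes T: "surj_phase_isometry X Y T"
    and fg: "f \<in> pos_unit_sphere X" "g \<in> pos_unit_sphere X"
  shows "sup_norm Y (\<lambda>y. T f y + T g y) = sup_norm X (\<lambda>x. f x + g x)"
proof -
  have "T f \<in> pos_unit_sphere Y" "T g \<in> pos_unit_sphere Y"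
    using T fg unfolding surj_phase_isometry_def by blast+
  note le = sphere_norm_diff_le_norm_add[OF this] sphere_norm_diff_le_norm_add[OF fg]
  have "{sup_norm Y (\<lambda>y. T f y + T g y), sup_norm Y (\<lambda>y. T f y - T g y)} =
        {sup_norm X (\<lambda>x. f x + g x), sup_norm X (\<lambda>x. f x - g x)}"
    using T fg unfolding surj_phase_isometry_def by blast
  with le show ?thesis
    unfolding doubleton_eq_iff by linarith
qed

section \<open>The linear extension\<close>

lemma C0_compose_homeomorphism:
  assumes \<sigma>: "homeomorphic_map Y X \<sigma>" and f: "f \<in> C0 X"
  shows "(\<lambda>y. if y \<in> topspace Y then f (\<sigma> y) else 0) \<in> C0 Y"
proof -
  obtain \<tau> where \<tau>: "continuous_map Y X \<sigma>" "continuous_map X Y \<tau>"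
    "\<And>y. y \<in> topspace Y \<Longrightarrow> \<tau> (\<sigma> y) = y" "\<And>x. x \<in> topspace X \<Longrightarrow> \<sigma> (\<tau> x) = x"
    using \<sigma> unfolding homeomorphic_map_maps homeomorphic_maps_def by blast
  let ?g = "\<lambda>y. if y \<in> topspace Y then f (\<sigma> y) else 0"
  have "continuous_map Y euclideanreal (f \<circ> \<sigma>)"
    using continuous_map_compose[OF \<tau>(1) C0_continuous[OF f]] .
  then have "continuous_map Y euclideanreal ?g"
    by (rule continuous_map_eq) simp
  moreover have "compactin Y {y \<in> topspace Y. \<epsilon> \<le> \<bar>?g y\<bar>}" if "\<epsilon> > 0" for \<epsilon>
  proof -
    have "compactin X {x \<in> topspace X. \<epsilon> \<le> \<bar>f x\<bar>}"
      using f that by (simp add: C0_def)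
    then have "compactin Y (\<tau> ` {x \<in> topspace X. \<epsilon> \<le> \<bar>f x\<bar>})"
      using image_compactin \<tau>(2) by blast
    moreover have "\<tau> ` {x \<in> topspace X. \<epsilon> \<le> \<bar>f x\<bar>} = {y \<in> topspace Y. \<epsilon> \<le> \<bar>?g y\<bar>}" (is "?A = ?B")
    proof
      show "?A \<subseteq> ?B"
        using \<tau>(4) continuous_map_image_subset_topspace[OF \<tau>(2)] by force
      show "?B \<subseteq> ?A"
      proof
        fix y assume "y \<in> ?B"
        then show "y \<in> ?A"
          using \<tau>(3)[of y] continuous_map_image_subset_topspace[OF \<tau>(1)]
          by (intro image_eqI[of _ _ "\<sigma> y"]) auto
      qed
    qed
    ultimately show ?thesis by simp
  qed
  ultimately show ?thesis unfolding C0_def by auto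
qed

lemma composition_surj_linear_isometry:
  fixes X :: "'a topology" and Y :: "'b topology"
  assumes \<sigma>: "homeomorphic_map Y X \<sigma>"
  shows "surj_linear_isometry X Y
    (\<lambda>f\<in>C0 X. \<lambda>y. if y \<in> topspace Y then f (\<sigma> y) else 0)"
    (is "surj_linear_isometry X Y ?C")
proof -
  obtain \<tau> where maps: "homeomorphic_maps Y X \<sigma> \<tau>"
    using \<sigma> homeomorphic_map_maps by blast
  have \<tau>: "homeomorphic_map X Y \<tau>" "\<And>y. y \<in> topspace Y \<Longrightarrow> \<tau> (\<sigma> y) = y"
  proof -
    show "homeomorphic_map X Y \<tau>"
      unfolding homeomorphic_map_maps using maps homeomorphic_maps_sym[of Y X] by blast
  qed (use maps in \<open>simp add: homeomorphic_maps_def\<close>)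
  have im: "\<sigma> ` topspace Y = topspace X"
    using \<sigma> by (simp add: homeomorphic_imp_surjective_map)
  have in_C0: "?C f \<in> C0 Y" if "f \<in> C0 X" for f
    using C0_compose_homeomorphism[OF \<sigma> that] that by simp
  have "\<exists>f\<in>C0 X. k = ?C f" if k: "k \<in> C0 Y" for k
  proof
    let ?f = "\<lambda>x. if x \<in> topspace X then k (\<tau> x) else 0"
    show f: "?f \<in> C0 X" by (rule C0_compose_homeomorphism[OF \<tau>(1) k])
    show "k = ?C ?f"
      by (rule C0_eqI[OF k in_C0[OF f]]) (use f im \<tau>(2) in auto)
  qed
  then have "?C ` C0 X = C0 Y" using in_C0 by blast
  moreover have "?C \<in> C0 X \<rightarrow>\<^sub>E C0 Y" using in_C0 by auto
  moreover have "?C (\<lambda>x. f x + g x) = (\<lambda>y. ?C f y + ?C g y)" if "f \<in> C0 X" "g \<in> C0 X" for f g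
    using that C0_add[OF that] by auto
  moreover have "?C (\<lambda>x. c * f x) = (\<lambda>y. c * ?C f y)" if "f \<in> C0 X" for c f
    using that C0_cmult[OF that] by auto
  moreover have "sup_norm Y (\<lambda>y. ?C f y - ?C g y) = sup_norm X (\<lambda>x. f x - g x)"
    if "f \<in> C0 X" "g \<in> C0 X" for f g
  proof -
    have "(\<lambda>y. \<bar>?C f y - ?C g y\<bar>) ` topspace Y = (\<lambda>x. \<bar>f x - g x\<bar>) ` topspace X"
      unfolding im[symmetric] image_image using that by (intro image_cong) auto
    then show ?thesis unfolding sup_norm_def by simp
  qed
  ultimately show ?thesis unfolding surj_linear_isometry_def by blast
qed

text \<open>
  Every function is a difference of its positive and negative parts, and each part is a multiple of a
  member of the sphere or zero. The sphere may be empty: then the zero function, written as 0 times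
  itself, is the only one.
\<close>

lemma linear_map_determined_by_sphere:
  assumes A: "surj_linear_isometry X Y A" and B: "surj_linear_isometry X Y B"
    and eq: "\<And>f. f \<in> pos_unit_sphere X \<Longrightarrow> A f = B f"
  shows "A = B"
proof -
  have add: "L (\<lambda>x. f x + g x) = (\<lambda>y. L f y + L g y)"
    if "surj_linear_isometry X Y L" "f \<in> C0 X" "g \<in> C0 X" for L f g
    using that unfolding surj_linear_isometry_def by blast
  have scale: "L (\<lambda>x. c * f x) = (\<lambda>y. c * L f y)"
    if "surj_linear_isometry X Y L" "f \<in> C0 X" for L f c
    using that unfolding surj_linear_isometry_def by blast
  have pos: "A p = B p" if p: "p \<in> C0 X" and nonneg: "\<And>x. x \<in> topspace X \<Longrightarrow> 0 \<le> p x" for p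
  proof (cases "sup_norm X p > 0")
    case True
    define s where "s = sup_norm X p"
    define u where "u = (\<lambda>x. (1/s) * p x)"
    have s: "s > 0" using True by (simp add: s_def)
    obtain x where x: "x \<in> topspace X" "\<bar>p x\<bar> = s"
      using sup_norm_attained[OF p True] unfolding s_def by blast
    have "0 \<le> u z \<and> u z \<le> 1" if "z \<in> topspace X" for z
      using abs_le_sup_norm[OF p that] nonneg[OF that] s unfolding u_def s_def
      by (simp add: field_simps)
    moreover have "u x = 1" using x nonneg[OF x(1)] s by (simp add: u_def)
    ultimately have u: "u \<in> pos_unit_sphere X"
      using x(1) C0_cmult[OF p] unfolding pos_unit_sphere_iff u_def by blast
    have su: "(\<lambda>x. s * u x) = p" using s by (auto simp: u_def)
    show ?thesis
      using scale[OF A pos_unit_sphere_C0[OF u], of s] scale[OF B pos_unit_sphere_C0[OF u], of s]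
      unfolding su eq[OF u] by simp
  next
    case False
    then have "\<forall>x\<in>topspace X. p x = 0"
      using sup_norm_le_iff[OF p, of 0] by auto
    then have zero: "(\<lambda>x. 0 * p x) = p" using C0_outside[OF p] by fastforce
    show ?thesis using scale[OF A p, of 0] scale[OF B p, of 0] unfolding zero by simp
  qed
  have on_C0: "A f = B f" if f: "f \<in> C0 X" for f
  proof -
    define p n where "p = (\<lambda>x. max (f x) 0)" and "n = (\<lambda>x. max ((-1) * f x) 0)"
    have C0: "p \<in> C0 X" "n \<in> C0 X"
      using C0_pos_part[OF f] C0_pos_part[OF C0_cmult[OF f, of "-1"]] by (simp_all add: p_def n_def)
    have f_eq: "(\<lambda>x. p x + (-1) * n x) = f" by (auto simp: p_def n_def)
    have "A p = B p" "A n = B n" using pos C0 by (auto simp: p_def n_def)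
    then show ?thesis
      using add[OF A C0(1) C0_cmult[OF C0(2)], of "-1"] add[OF B C0(1) C0_cmult[OF C0(2)], of "-1"]
      unfolding f_eq scale[OF A C0(2)] scale[OF B C0(2)] by simp
  qed
  have "A \<in> C0 X \<rightarrow>\<^sub>E C0 Y" "B \<in> C0 X \<rightarrow>\<^sub>E C0 Y"
    using A B by (simp_all add: surj_linear_isometry_def)
  then show ?thesis by (rule PiE_ext) (rule on_C0)
qed

theorem theorem4p1:
  fixes X :: "'a topology" and Y :: "'b topology"
    and T :: "('a \<Rightarrow> real) \<Rightarrow> ('b \<Rightarrow> real)"
  assumes "locally_compact_space X" and "Hausdorff_space X"
    and "locally_compact_space Y" and "Hausdorff_space Y"
    and "surj_phase_isometry X Y T"
  shows "(\<exists>\<sigma>. homeomorphic_map Y X \<sigma> \<and>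
            (\<forall>f \<in> pos_unit_sphere X. \<forall>y \<in> topspace Y. T f y = f (\<sigma> y))) \<and>
         (\<exists>!T'. surj_linear_isometry X Y T' \<and> (\<forall>f \<in> pos_unit_sphere X. T' f = T f))"
proof -
  interpret norm_additive_surjection X Y T
    by unfold_locales (use assms in \<open>auto simp: phase_isometry_norm_add surj_phase_isometry_def\<close>)
  obtain \<sigma> where \<sigma>: "homeomorphic_map Y X \<sigma>"
    and T: "\<And>f y. f \<in> pos_unit_sphere X \<Longrightarrow> y \<in> topspace Y \<Longrightarrow> T f y = f (\<sigma> y)"
    using homeomorphism by blast
  define C where "C = (\<lambda>f\<in>C0 X. \<lambda>y. if y \<in> topspace Y then f (\<sigma> y) else 0)"
  have C: "surj_linear_isometry X Y C"
    unfolding C_def by (rule composition_surj_linear_isometry[OF \<sigma>])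
  have extends: "C f = T f" if f: "f \<in> pos_unit_sphere X" for f
    using T[OF f] C0_outside[OF pos_unit_sphere_C0[OF T_in[OF f]]] pos_unit_sphere_C0[OF f]
    by (auto simp: C_def)
  have "\<exists>!T'. surj_linear_isometry X Y T' \<and> (\<forall>f \<in> pos_unit_sphere X. T' f = T f)"
  proof (rule ex1I)
    show "surj_linear_isometry X Y C \<and> (\<forall>f \<in> pos_unit_sphere X. C f = T f)"
      using C extends by blast
    fix T' assume "surj_linear_isometry X Y T' \<and> (\<forall>f \<in> pos_unit_sphere X. T' f = T f)"
    then show "T' = C"
      using linear_map_determined_by_sphere[of X Y T' C] C extends by simp
  qed
  with \<sigma> T show ?thesis by blast
qed

end
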